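(* Let $(S,\Sigma,\mu)$ be a measure space with $\mu(S)=1$, let $\Phi=(\varphi_n)_{n\in\mathbb{N}}$ be a uniformly bounded orthonormal system of scalar functions on $S$, and let $X$ be a Banach space with nontrivial $\Phi$-type. Let $b>0$ and $\rho>0$. There exist positive constants $a(\rho,b)$ and $A(\rho,b)$ such that every sequence $(c_n)_{n\in\mathbb{N}}$ in $X$ with $$\sum_{n=1}^\infty\|c_n\|_X\Big(\log^+\Big(\frac{1}{\|c_n\|_X}\Big)\Big)^{-b}\le\rho$$ is the sequence of Fourier coefficients (with respect to $\Phi$) of a function $f$ such that $$\int_S\exp\Big(a(\rho,b)\,\|f(s)\|_X^{\frac1b}\Big)\,d\mu(s)\le A(\rho,b).$$
   Context: $\log^+(t)=\log(2+t)$; terms with $c_n=0$ are interpreted as $0$. Uniformly bounded means $|\varphi_n(s)|\le C$ for all $n\in\mathbb{N}$, $s\in S$, for some constant $C$. For $f\in L^1(S;X)$ the $n$-th Fourier coefficient is $c_n(f)=\int_Sf(s)\overline{\varphi_n(s)}\,d\mu(s)$. For $p\in[1,2]$ with $1/p+1/p'=1$, $X$ has $\Phi$-type $p$ if there is $C>0$ such that $\big(\int_S\|\sum_{k=1}^n\varphi_k(s)x_k\|_X^{p'}\,d\mu(s)\big)^{1/p'}\le C\big(\sum_{k=1}^n\|x_k\|_X^p\big)^{1/p}$ for all $n$ and all $x_1,\dots,x_n\in X$ (essential supremum if $p'=\infty$); it has nontrivial $\Phi$-type if it has $\Phi$-type $p$ for some $p\in(1,2]$. The constants $a,A$ do not depend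 on the sequence $(c_n)$; they may also depend on $X$ and $\Phi$. *)

theory Defs
  imports "HOL-Analysis.Analysis" "HOL-Probability.Essential_Supremum"
begin

text \<open>
  The scalar field is either \<open>\<real>\<close> or \<open>\<complex>\<close>. By the Gelfand--Mazur theorem the class below has no other
  members, up to isometric isomorphism: the norm of a \<open>real_normed_field\<close> is multiplicative.
\<close>

class rc_scalar = real_normed_field + banach + second_countable_topology +
  fixes scalar_conj :: "'a \<Rightarrow> 'a"
  assumes scalar_conj_add: "scalar_conj (x + y) = scalar_conj x + scalar_conj y"
    and mult_scalar_conj: "x * scalar_conj x = (norm x)\<^sup>2 *\<^sub>R 1"

instantiation real :: rc_scalar
begin

definition scalar_conj_real :: "real \<Rightarrow> real" where
  "scalar_conj_real x = x"

instance
  by standard (simp_all add: scalar_conj_real_def power2_eq_square)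

end

instantiation complex :: rc_scalar
begin

definition scalar_conj_complex :: "complex \<Rightarrow> complex" where
  "scalar_conj_complex z = cnj z"

instance
  by standard (simp_all add: scalar_conj_complex_def complex_norm_square scaleR_conv_of_real del: of_real_power)

end

text \<open>
  A Banach space over the scalar field. The type class \<open>banach\<close> provides only the real structure;
  \<open>smul\<close> is the multiplication by scalars, extending \<open>scaleR\<close> (and equal to it over \<open>\<real>\<close>).
\<close>

locale banach_over = vector_space smul
  for smul :: "'k::rc_scalar \<Rightarrow> 'x::banach \<Rightarrow> 'x" +
  assumes smul_of_real: "smul (of_real r) x = r *\<^sub>R x"
    and norm_smul: "norm (smul c x) = norm c * norm x"

text \<open>
  The Bochner integral of the library is confined to second countable (separable) target spaces.
  The following is the same notion for arbitrary Banach spaces, with Borel measurability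
  replaced by strong measurability.
\<close>

definition strongly_measurable :: "'s measure \<Rightarrow> ('s \<Rightarrow> 'x::real_normed_vector) \<Rightarrow> bool" where
  "strongly_measurable M f \<longleftrightarrow>
     (\<exists>u. (\<forall>i. simple_function M (u i)) \<and> (\<forall>s\<in>space M. (\<lambda>i. u i s) \<longlonglongrightarrow> f s))"

definition bochner_L1 :: "'s measure \<Rightarrow> ('s \<Rightarrow> 'x::real_normed_vector) \<Rightarrow> bool" where
  "bochner_L1 M f \<longleftrightarrow> strongly_measurable M f \<and> (\<integral>\<^sup>+s. ennreal (norm (f s)) \<partial>M) < \<infinity>"

definition has_strong_bochner_integral ::
    "'s measure \<Rightarrow> ('s \<Rightarrow> 'x::real_normed_vector) \<Rightarrow> 'x \<Rightarrow> bool" where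
  "has_strong_bochner_integral M f x \<longleftrightarrow>
     strongly_measurable M f \<and>
     (\<exists>u. (\<forall>i. Bochner_Integration.simple_bochner_integrable M (u i)) \<and>
          (\<lambda>i. \<integral>\<^sup>+s. ennreal (norm (f s - u i s)) \<partial>M) \<longlonglongrightarrow> 0 \<and>
          (\<lambda>i. Bochner_Integration.simple_bochner_integral M (u i)) \<longlonglongrightarrow> x)"

lemma strongly_measurable_iff_borel_measurable:
  fixes f :: "'s \<Rightarrow> 'x::{real_normed_vector, second_countable_topology}"
  shows "strongly_measurable M f \<longleftrightarrow> f \<in> borel_measurable M"
proof
  assume "strongly_measurable M f"
  then obtain u where "\<And>i. simple_function M (u i)" "\<And>s. s \<in> space M \<Longrightarrow> (\<lambda>i. u i s) \<longlonglongrightarrow> f s"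
    by (auto simp: strongly_measurable_def)
  then show "f \<in> borel_measurable M"
    by (blast intro: borel_measurable_LIMSEQ_metric borel_measurable_simple_function)
next
  assume "f \<in> borel_measurable M"
  then show "strongly_measurable M f"
    unfolding strongly_measurable_def
    using borel_measurable_implies_sequence_metric[of f M 0] by blast
qed

lemma has_strong_bochner_integral_iff:
  fixes f :: "'s \<Rightarrow> 'x::{real_normed_vector, second_countable_topology}"
  shows "has_strong_bochner_integral M f x \<longleftrightarrow> has_bochner_integral M f x"
  by (auto simp: has_strong_bochner_integral_def has_bochner_integral.simps
      strongly_measurable_iff_borel_measurable)

text \<open>All sequences are indexed by \<open>nat\<close> starting from 0 instead of 1.\<close>

definition orthonormal_system :: "'s measure \<Rightarrow> (nat \<Rightarrow> 's \<Rightarrow> 'k::rc_scalar) \<Rightarrow> bool" where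
  "orthonormal_system M \<phi> \<longleftrightarrow>
     (\<forall>n. \<phi> n \<in> borel_measurable M \<and> integrable M (\<lambda>s. (norm (\<phi> n s))\<^sup>2)) \<and>
     (\<forall>m n. (\<integral>s. \<phi> m s * scalar_conj (\<phi> n s) \<partial>M) = (if m = n then 1 else 0))"

definition uniformly_bounded_system :: "'s measure \<Rightarrow> (nat \<Rightarrow> 's \<Rightarrow> 'k::rc_scalar) \<Rightarrow> bool" where
  "uniformly_bounded_system M \<phi> \<longleftrightarrow> (\<exists>C. \<forall>n. \<forall>s\<in>space M. norm (\<phi> n s) \<le> C)"

definition has_fourier_coeff ::
    "'s measure \<Rightarrow> ('k::rc_scalar \<Rightarrow> 'x::banach \<Rightarrow> 'x) \<Rightarrow> (nat \<Rightarrow> 's \<Rightarrow> 'k) \<Rightarrow>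
     ('s \<Rightarrow> 'x) \<Rightarrow> nat \<Rightarrow> 'x \<Rightarrow> bool" where
  "has_fourier_coeff M smul \<phi> f n x \<longleftrightarrow>
     has_strong_bochner_integral M (\<lambda>s. smul (scalar_conj (\<phi> n s)) (f s)) x"

text \<open>
  The conjugate exponent of \<open>p\<close> is \<open>p / (p - 1)\<close> if \<open>p > 1\<close>. For a uniformly bounded system on a
  probability space the integrand below is bounded and measurable, so that the real-valued
  integral is the true one.
\<close>

definition has_Phi_type ::
    "'s measure \<Rightarrow> ('k::rc_scalar \<Rightarrow> 'x::banach \<Rightarrow> 'x) \<Rightarrow> (nat \<Rightarrow> 's \<Rightarrow> 'k) \<Rightarrow> real \<Rightarrow> bool" where
  "has_Phi_type M smul \<phi> p \<longleftrightarrow> 1 \<le> p \<and> p \<le> 2 \<and>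
     (\<exists>C>0. \<forall>n x.
        if p = 1
        then esssup M (\<lambda>s. ereal (norm (\<Sum>k<n. smul (\<phi> k s) (x k))))
               \<le> ereal (C * (\<Sum>k<n. norm (x k)))
        else (let p' = p / (p - 1) in
               (\<integral>s. norm (\<Sum>k<n. smul (\<phi> k s) (x k)) powr p' \<partial>M) powr (1 / p')
                 \<le> C * (\<Sum>k<n. norm (x k) powr p) powr (1 / p)))"

definition nontrivial_Phi_type ::
    "'s measure \<Rightarrow> ('k::rc_scalar \<Rightarrow> 'x::banach \<Rightarrow> 'x) \<Rightarrow> (nat \<Rightarrow> 's \<Rightarrow> 'k) \<Rightarrow> bool" where
  "nontrivial_Phi_type M smul \<phi> \<longleftrightarrow> (\<exists>p. 1 < p \<and> p \<le> 2 \<and> has_Phi_type M smul \<phi> p)"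

definition log_plus :: "real \<Rightarrow> real" where
  "log_plus t = ln (2 + t)"

text \<open>For \<open>x = 0\<close> this is 0, as required, because of the factor \<open>norm x\<close>.\<close>

definition log_weight :: "real \<Rightarrow> 'x::real_normed_vector \<Rightarrow> real" where
  "log_weight b x = norm x * log_plus (1 / norm x) powr (- b)"

end

theory Submission
  imports Defs "HOL-Probability.Probability_Measure"
begin

text \<open>
  For a partial sum and \<open>m \<ge> 1\<close>, the coefficients of norm above \<open>exp (- m)\<close> have total norm at most of
  order \<open>m powr b\<close>, by the hypothesis on the weights, so their contribution is bounded by a multiple
  of \<open>m powr b\<close>. The remaining coefficients have \<open>p\<close>-th powers summing to an exponentially small
  amount, so by the \<open>\<Phi>\<close>-type inequality and Chebyshev their contribution exceeds 1 only with probability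
  of order \<open>exp (- m / 2)\<close>. This tail estimate gives the exponential integrability of the partial sums,
  uniformly. By the type inequality the partial sums are also Cauchy in \<open>L\<^sup>1\<close>; their limit
  has the prescribed coefficients and inherits the bound by Fatou's lemma.
\<close>

subsection \<open>Strong measurability and the strong Bochner integral\<close>

lemma strongly_measurable_simple: "simple_function M f \<Longrightarrow> strongly_measurable M f"
  unfolding strongly_measurable_def by (intro exI[of _ "\<lambda>_. f"]) auto

text \<open>A continuous \<open>h\<close> carries pointwise approximation by simple functions over
  to the composite. Continuity is asked of the uncurried map, so that sums, differences and products
  by real or general scalars are all instances.\<close>

lemma strongly_measurable_compose2:
  assumes "strongly_measurable M f" "strongly_measurable M g"
    and h: "\<And>x y. isCont (\<lambda>z. h (fst z) (snd z)) (x, y)"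
  shows "strongly_measurable M (\<lambda>s. h (f s) (g s))"
proof -
  obtain u v where u: "\<And>i. simple_function M (u i)" "\<And>s. s \<in> space M \<Longrightarrow> (\<lambda>i. u i s) \<longlonglongrightarrow> f s"
    and v: "\<And>i. simple_function M (v i)" "\<And>s. s \<in> space M \<Longrightarrow> (\<lambda>i. v i s) \<longlonglongrightarrow> g s"
    using assms(1,2) unfolding strongly_measurable_def by blast
  have "simple_function M (\<lambda>s. h (u i s) (v i s))" for i
    using u(1) v(1) by (rule simple_function_compose2)
  moreover have "(\<lambda>i. h (u i s) (v i s)) \<longlonglongrightarrow> h (f s) (g s)" if "s \<in> space M" for s
    using isCont_tendsto_compose[OF h tendsto_Pair[OF u(2)[OF that] v(2)[OF that]]] by simp
  ultimately show ?thesis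
    unfolding strongly_measurable_def by (intro exI[of _ "\<lambda>i s. h (u i s) (v i s)"]) auto
qed

lemma strongly_measurable_add:
  "strongly_measurable M f \<Longrightarrow> strongly_measurable M g \<Longrightarrow> strongly_measurable M (\<lambda>s. f s + g s)"
  by (rule strongly_measurable_compose2[where h = "(+)"]) (auto intro!: continuous_intros)

lemma strongly_measurable_diff:
  "strongly_measurable M f \<Longrightarrow> strongly_measurable M g \<Longrightarrow> strongly_measurable M (\<lambda>s. f s - g s)"
  by (rule strongly_measurable_compose2[where h = "(-)"]) (auto intro!: continuous_intros)

lemma strongly_measurable_scaleR:
  "strongly_measurable M f \<Longrightarrow> strongly_measurable M g \<Longrightarrow> strongly_measurable M (\<lambda>s. f s *\<^sub>R g s)"
  by (rule strongly_measurable_compose2[where h = scaleR]) (auto intro!: continuous_intros)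

lemma strongly_measurable_sum:
  "(\<And>i. i \<in> I \<Longrightarrow> strongly_measurable M (f i)) \<Longrightarrow> strongly_measurable M (\<lambda>s. \<Sum>i\<in>I. f i s)"
  by (induction I rule: infinite_finite_induct)
    (auto intro: strongly_measurable_add strongly_measurable_simple)

lemma strongly_measurable_norm:
  assumes "strongly_measurable M f"
  shows "(\<lambda>s. norm (f s)) \<in> borel_measurable M"
proof -
  obtain u where u: "\<And>i. simple_function M (u i)" "\<And>s. s \<in> space M \<Longrightarrow> (\<lambda>i. u i s) \<longlonglongrightarrow> f s"
    using assms unfolding strongly_measurable_def by blast
  have "(\<lambda>s. norm (u i s)) \<in> borel_measurable M" for i
    using simple_function_compose1[OF u(1), of norm] by (rule borel_measurable_simple_function)
  then show ?thesis
    by (rule borel_measurable_LIMSEQ_real[rotated]) (auto intro!: tendsto_norm u(2))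
qed

text \<open>The simple functions choose a nearest point among the first \<open>i + 1\<close> points of the dense sequence.\<close>

lemma strongly_measurable_dense:
  fixes f :: "'s \<Rightarrow> 'x::real_normed_vector" and d :: "nat \<Rightarrow> 'x"
  assumes meas: "\<And>k. (\<lambda>s. norm (f s - d k)) \<in> borel_measurable M"
    and dense: "\<And>s e. s \<in> space M \<Longrightarrow> e > 0 \<Longrightarrow> \<exists>k. norm (f s - d k) < e"
  shows "strongly_measurable M f"
proof -
  define P where "P i s k \<longleftrightarrow> k \<le> i \<and> (\<forall>j\<in>{..i}. norm (f s - d k) \<le> norm (f s - d j))" for i s k
  \<comment> \<open>\<open>LEAST\<close> settles ties between equally near points, which keeps
    \<open>\<kappa> i\<close> measurable; its values are at most \<open>i\<close>, so it is
    simple.\<close>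
  define \<kappa> where "\<kappa> i s = (LEAST k. P i s k)" for i s
  have P: "P i s (\<kappa> i s)" for i s
  proof -
    obtain k where "is_arg_min (\<lambda>j. norm (f s - d j)) (\<lambda>j. j \<in> {..i}) k"
      using ex_is_arg_min_if_finite[of "{..i}" "\<lambda>j. norm (f s - d j)"] by auto
    then have "\<exists>k. P i s k"
      unfolding P_def is_arg_min_linorder by blast
    then show ?thesis
      unfolding \<kappa>_def by (rule LeastI_ex)
  qed
  define r where "r k s = norm (f s - d k)" for k s
  have [measurable]: "r k \<in> borel_measurable M" for k
    unfolding r_def by (rule meas)
  have [measurable]: "\<kappa> i \<in> measurable M (count_space UNIV)" for i
    unfolding \<kappa>_def[abs_def] P_def r_def[symmetric] by measurable
  have "simple_function M (\<kappa> i)" for i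
    unfolding simple_function_def
  proof safe
    have "\<kappa> i s \<le> i" for s
      using P[of i s] unfolding P_def by blast
    then show "finite (\<kappa> i ` space M)"
      by (auto intro: finite_subset[of _ "{..i}"])
  qed measurable
  then have "simple_function M (\<lambda>s. d (\<kappa> i s))" for i
    by (rule simple_function_compose1)
  moreover have "(\<lambda>i. d (\<kappa> i s)) \<longlonglongrightarrow> f s" if s: "s \<in> space M" for s
  proof (rule LIMSEQ_I)
    fix e :: real assume "e > 0"
    then obtain k where k: "norm (f s - d k) < e"
      using dense s by blast
    have "norm (d (\<kappa> i s) - f s) < e" if "i \<ge> k" for i
    proof -
      have "norm (f s - d (\<kappa> i s)) \<le> norm (f s - d k)"
        using P[of i s] that unfolding P_def by blast
      then show ?thesis
        using k by (simp add: norm_minus_commute)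
    qed
    then show "\<exists>N. \<forall>i\<ge>N. norm (d (\<kappa> i s) - f s) < e"
      by blast
  qed
  ultimately show ?thesis
    unfolding strongly_measurable_def by (intro exI[of _ "\<lambda>i s. d (\<kappa> i s)"]) auto
qed

text \<open>The values of all simple functions approximating all \<open>F n\<close> form a countable
  set that comes arbitrarily close to every \<open>f s\<close>. Distances from \<open>f\<close> to
  its points are limits of measurable functions, so the criterion with a dense sequence
  applies.\<close>

lemma strongly_measurable_LIMSEQ:
  fixes f :: "'s \<Rightarrow> 'x::real_normed_vector"
  assumes "\<And>n. strongly_measurable M (F n)"
    and lim: "\<And>s. s \<in> space M \<Longrightarrow> (\<lambda>n. F n s) \<longlonglongrightarrow> f s"
  shows "strongly_measurable M f"
\<comment> \<open>The set \<open>D\<close> below is nonempty only over a nonempty space, and only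
  then does \<open>from_nat_into\<close> enumerate it.\<close>
proof (cases "space M = {}")
  case True
  then show ?thesis
    by (auto simp: strongly_measurable_def simple_function_def intro!: exI[of _ "\<lambda>_ _. 0"])
next
  case False
  obtain u where u: "\<And>n i. simple_function M (u n i)"
      "\<And>n s. s \<in> space M \<Longrightarrow> (\<lambda>i. u n i s) \<longlonglongrightarrow> F n s"
    using assms(1) unfolding strongly_measurable_def by metis
  define D where "D = (\<Union>n i. u n i ` space M)"
  have "countable D"
    unfolding D_def using u(1) by (intro countable_UN) (auto intro!: countable_finite simp: simple_function_def)
  moreover have "D \<noteq> {}"
    using False by (auto simp: D_def)
  ultimately have D: "range (from_nat_into D) = D"
    by (rule range_from_nat_into[rotated])
  show ?thesis
  proof (rule strongly_measurable_dense[of f "from_nat_into D"])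
    fix k
    have "strongly_measurable M (\<lambda>s. F n s - from_nat_into D k)" for n
      by (intro strongly_measurable_diff assms(1) strongly_measurable_simple) auto
    then have "(\<lambda>s. norm (F n s - from_nat_into D k)) \<in> borel_measurable M" for n
      by (rule strongly_measurable_norm)
    then show "(\<lambda>s. norm (f s - from_nat_into D k)) \<in> borel_measurable M"
      by (rule borel_measurable_LIMSEQ_real[rotated]) (auto intro!: tendsto_intros lim)
  next
    fix s and e :: real assume s: "s \<in> space M" and "e > 0"
    then have e: "e / 2 > 0" by simp
    obtain n where n: "norm (F n s - f s) < e / 2"
      using LIMSEQ_D[OF lim[OF s] e] by blast
    obtain i where i: "norm (u n i s - F n s) < e / 2"
      using LIMSEQ_D[OF u(2)[OF s] e] by blast
    have "u n i s \<in> range (from_nat_into D)"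
      unfolding D using s by (auto simp: D_def)
    then obtain k where k: "u n i s = from_nat_into D k" by blast
    have "norm ((F n s - f s) + (u n i s - F n s)) < e / 2 + e / 2"
      using n i by (rule norm_add_less)
    then have "norm (f s - u n i s) < e"
      by (simp add: norm_minus_commute)
    then show "\<exists>k. norm (f s - from_nat_into D k) < e"
      unfolding k by blast
  qed
qed

section \<open>Sums, limits and linear images under the strong Bochner integral\<close>

lemma has_strong_bochner_integral_add:
  fixes f g :: "'s \<Rightarrow> 'x::real_normed_vector"
  assumes "has_strong_bochner_integral M f x" "has_strong_bochner_integral M g y"
  shows "has_strong_bochner_integral M (\<lambda>s. f s + g s) (x + y)"
proof -
  obtain u v where f: "strongly_measurable M f" and g: "strongly_measurable M g"
    and u: "\<And>i. Bochner_Integration.simple_bochner_integrable M (u i)"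
      "(\<lambda>i. \<integral>\<^sup>+s. ennreal (norm (f s - u i s)) \<partial>M) \<longlonglongrightarrow> 0"
      "(\<lambda>i. Bochner_Integration.simple_bochner_integral M (u i)) \<longlonglongrightarrow> x"
    and v: "\<And>i. Bochner_Integration.simple_bochner_integrable M (v i)"
      "(\<lambda>i. \<integral>\<^sup>+s. ennreal (norm (g s - v i s)) \<partial>M) \<longlonglongrightarrow> 0"
      "(\<lambda>i. Bochner_Integration.simple_bochner_integral M (v i)) \<longlonglongrightarrow> y"
    using assms unfolding has_strong_bochner_integral_def by blast
  have sm: "strongly_measurable M (u i)" "strongly_measurable M (v i)" for i
    using u(1) v(1) by (auto intro: strongly_measurable_simple simp: simple_bochner_integrable.simps)
  note [measurable] = strongly_measurable_norm[OF strongly_measurable_diff[OF f sm(1)]]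
    strongly_measurable_norm[OF strongly_measurable_diff[OF g sm(2)]]
  have "(\<lambda>i. \<integral>\<^sup>+s. ennreal (norm (f s + g s - (u i s + v i s))) \<partial>M) \<longlonglongrightarrow> 0"
  proof (rule tendsto_sandwich[OF _ _ tendsto_const])
    have "(\<integral>\<^sup>+s. ennreal (norm (f s + g s - (u i s + v i s))) \<partial>M)
        \<le> (\<integral>\<^sup>+s. ennreal (norm (f s - u i s)) + ennreal (norm (g s - v i s)) \<partial>M)" for i
      by (intro nn_integral_mono) (simp flip: ennreal_plus add: norm_diff_triangle_ineq)
    then show "\<forall>\<^sub>F i in sequentially. (\<integral>\<^sup>+s. ennreal (norm (f s + g s - (u i s + v i s))) \<partial>M)
        \<le> (\<integral>\<^sup>+s. ennreal (norm (f s - u i s)) \<partial>M) + (\<integral>\<^sup>+s. ennreal (norm (g s - v i s)) \<partial>M)"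
      by (simp add: nn_integral_add)
    show "(\<lambda>i. (\<integral>\<^sup>+s. ennreal (norm (f s - u i s)) \<partial>M)
        + (\<integral>\<^sup>+s. ennreal (norm (g s - v i s)) \<partial>M)) \<longlonglongrightarrow> 0"
      using tendsto_add[OF u(2) v(2)] by simp
  qed auto
  moreover have "(\<lambda>i. Bochner_Integration.simple_bochner_integral M (\<lambda>s. u i s + v i s)) \<longlonglongrightarrow> x + y"
    using tendsto_add[OF u(3) v(3)] by (simp add: simple_bochner_integral_add[OF u(1) v(1)])
  ultimately show ?thesis
    unfolding has_strong_bochner_integral_def
    using strongly_measurable_add[OF f g] simple_bochner_integrable_compose2[OF _ u(1) v(1), of "(+)"]
    by (intro conjI exI[of _ "\<lambda>i s. u i s + v i s"]) simp_all
qed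

text \<open>Diagonal choice: for each \<open>j\<close> one simple function is taken that is close to
  \<open>F j\<close> in L1 and whose integral is close to \<open>x j\<close>, both with error below
  \<open>inverse (Suc j)\<close>.\<close>

lemma has_strong_bochner_integral_LIMSEQ:
  fixes f :: "'s \<Rightarrow> 'x::real_normed_vector"
  assumes F: "\<And>j. has_strong_bochner_integral M (F j) (x j)"
    and f: "strongly_measurable M f"
    and lim: "(\<lambda>j. \<integral>\<^sup>+s. ennreal (norm (f s - F j s)) \<partial>M) \<longlonglongrightarrow> 0" "x \<longlonglongrightarrow> y"
  shows "has_strong_bochner_integral M f y"
proof -
  have "\<exists>u. Bochner_Integration.simple_bochner_integrable M u \<and>
      (\<integral>\<^sup>+s. ennreal (norm (F j s - u s)) \<partial>M) < ennreal (inverse (Suc j)) \<and>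
      norm (Bochner_Integration.simple_bochner_integral M u - x j) < inverse (Suc j)" for j
  proof -
    obtain u where u: "\<And>i. Bochner_Integration.simple_bochner_integrable M (u i)"
      "(\<lambda>i. \<integral>\<^sup>+s. ennreal (norm (F j s - u i s)) \<partial>M) \<longlonglongrightarrow> 0"
      "(\<lambda>i. Bochner_Integration.simple_bochner_integral M (u i)) \<longlonglongrightarrow> x j"
      using F[of j] unfolding has_strong_bochner_integral_def by blast
    have "\<forall>\<^sub>F i in sequentially. (\<integral>\<^sup>+s. ennreal (norm (F j s - u i s)) \<partial>M) < ennreal (inverse (Suc j))"
      by (rule order_tendstoD(2)[OF u(2)]) simp
    moreover have "\<forall>\<^sub>F i in sequentially.
        norm (Bochner_Integration.simple_bochner_integral M (u i) - x j) < inverse (Suc j)"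
      using tendstoD[OF u(3), of "inverse (Suc j)"] by (simp add: dist_norm)
    ultimately have "\<forall>\<^sub>F i in sequentially.
        (\<integral>\<^sup>+s. ennreal (norm (F j s - u i s)) \<partial>M) < ennreal (inverse (Suc j)) \<and>
        norm (Bochner_Integration.simple_bochner_integral M (u i) - x j) < inverse (Suc j)"
      by (rule eventually_conj)
    then show ?thesis
      using u(1) unfolding eventually_sequentially by blast
  qed
  then obtain u where u: "\<And>j. Bochner_Integration.simple_bochner_integrable M (u j)"
      "\<And>j. (\<integral>\<^sup>+s. ennreal (norm (F j s - u j s)) \<partial>M) < ennreal (inverse (Suc j))"
      "\<And>j. norm (Bochner_Integration.simple_bochner_integral M (u j) - x j) < inverse (Suc j)"
    by metis
  have Fj: "strongly_measurable M (F j)" for j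
    using F by (simp add: has_strong_bochner_integral_def)
  have uj: "strongly_measurable M (u j)" for j
    using u(1)[of j] by (auto intro: strongly_measurable_simple simp: simple_bochner_integrable.simps)
  note [measurable] = strongly_measurable_norm[OF strongly_measurable_diff[OF f Fj]]
    strongly_measurable_norm[OF strongly_measurable_diff[OF Fj uj]]
  have "(\<lambda>j. \<integral>\<^sup>+s. ennreal (norm (f s - u j s)) \<partial>M) \<longlonglongrightarrow> 0"
  proof (rule tendsto_sandwich[OF _ _ tendsto_const])
    have "(\<integral>\<^sup>+s. ennreal (norm (f s - u j s)) \<partial>M)
        \<le> (\<integral>\<^sup>+s. ennreal (norm (f s - F j s)) \<partial>M) + ennreal (inverse (Suc j))" for j
    proof -
      have "(\<integral>\<^sup>+s. ennreal (norm (f s - u j s)) \<partial>M)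
          \<le> (\<integral>\<^sup>+s. ennreal (norm (f s - F j s)) + ennreal (norm (F j s - u j s)) \<partial>M)"
        by (intro nn_integral_mono) (simp flip: ennreal_plus add: norm_diff_triangle_le[OF order_refl order_refl])
      also have "\<dots> = (\<integral>\<^sup>+s. ennreal (norm (f s - F j s)) \<partial>M) + (\<integral>\<^sup>+s. ennreal (norm (F j s - u j s)) \<partial>M)"
        by (rule nn_integral_add) measurable
      finally show ?thesis
        using u(2)[of j] by (meson add_left_mono less_imp_le order_trans)
    qed
    then show "\<forall>\<^sub>F j in sequentially. (\<integral>\<^sup>+s. ennreal (norm (f s - u j s)) \<partial>M)
        \<le> (\<integral>\<^sup>+s. ennreal (norm (f s - F j s)) \<partial>M) + ennreal (inverse (Suc j))"
      by simp
    show "(\<lambda>j. (\<integral>\<^sup>+s. ennreal (norm (f s - F j s)) \<partial>M) + ennreal (inverse (Suc j))) \<longlonglongrightarrow> 0"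
      using tendsto_add[OF lim(1) tendsto_ennrealI[OF LIMSEQ_inverse_real_of_nat]] by simp
  qed auto
  moreover have "(\<lambda>j. Bochner_Integration.simple_bochner_integral M (u j)) \<longlonglongrightarrow> y"
  proof -
    have "(\<lambda>j. Bochner_Integration.simple_bochner_integral M (u j) - x j) \<longlonglongrightarrow> 0"
      using u(3) by (intro Lim_null_comparison[OF _ LIMSEQ_inverse_real_of_nat]) (auto intro!: always_eventually less_imp_le)
    from tendsto_add[OF this lim(2)] show ?thesis by simp
  qed
  ultimately show ?thesis
    unfolding has_strong_bochner_integral_def using f u(1) by blast
qed

text \<open>\<open>T\<close> is applied to the approximating simple functions, and its norm bound
  controls the L1 error. With \<open>T = (\<lambda>a. smul a x)\<close> this turns scalar
  orthogonality relations into vector-valued ones.\<close>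

lemma has_strong_bochner_integral_bounded_linear:
  fixes \<psi> :: "'s \<Rightarrow> 'k::{real_normed_vector, second_countable_topology}"
    and T :: "'k \<Rightarrow> 'x::real_normed_vector"
  assumes \<psi>: "has_bochner_integral M \<psi> z" and T: "bounded_linear T"
  shows "has_strong_bochner_integral M (\<lambda>s. T (\<psi> s)) (T z)"
proof -
  interpret bounded_linear T by fact
  obtain B where B: "\<And>x. norm (T x) \<le> norm x * B" "B > 0"
    using pos_bounded by blast
  obtain u where [measurable]: "\<psi> \<in> borel_measurable M"
    and u: "\<And>i. Bochner_Integration.simple_bochner_integrable M (u i)"
      "(\<lambda>i. \<integral>\<^sup>+s. ennreal (norm (\<psi> s - u i s)) \<partial>M) \<longlonglongrightarrow> 0"
      "(\<lambda>i. Bochner_Integration.simple_bochner_integral M (u i)) \<longlonglongrightarrow> z"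
    using \<psi> by (auto simp: has_bochner_integral.simps)
  have [measurable]: "u i \<in> borel_measurable M" for i
    using u(1)[of i] by (auto simp: simple_bochner_integrable.simps intro: borel_measurable_simple_function)
  have "(\<lambda>i. \<integral>\<^sup>+s. ennreal (norm (T (\<psi> s) - T (u i s))) \<partial>M) \<longlonglongrightarrow> 0"
  proof (rule tendsto_sandwich[OF _ _ tendsto_const])
    have "(\<integral>\<^sup>+s. ennreal (norm (T (\<psi> s) - T (u i s))) \<partial>M)
        \<le> (\<integral>\<^sup>+s. ennreal B * ennreal (norm (\<psi> s - u i s)) \<partial>M)" for i
      using B by (intro nn_integral_mono) (simp flip: ennreal_mult diff add: mult.commute)
    then show "\<forall>\<^sub>F i in sequentially. (\<integral>\<^sup>+s. ennreal (norm (T (\<psi> s) - T (u i s))) \<partial>M)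
        \<le> ennreal B * (\<integral>\<^sup>+s. ennreal (norm (\<psi> s - u i s)) \<partial>M)"
      by (simp add: nn_integral_cmult)
    show "(\<lambda>i. ennreal B * (\<integral>\<^sup>+s. ennreal (norm (\<psi> s - u i s)) \<partial>M)) \<longlonglongrightarrow> 0"
      using ennreal_tendsto_cmult[OF _ u(2), of "ennreal B"] by simp
  qed auto
  moreover have "(\<lambda>i. Bochner_Integration.simple_bochner_integral M (\<lambda>s. T (u i s))) \<longlonglongrightarrow> T z"
    using tendsto[OF u(3)] by (simp add: simple_bochner_integral_linear[OF linear_axioms u(1)])
  moreover have \<psi>: "strongly_measurable M \<psi>"
    by (simp add: strongly_measurable_iff_borel_measurable)
  have "strongly_measurable M (\<lambda>s. T (\<psi> s))"
    by (rule strongly_measurable_compose2[where h = "\<lambda>x _. T x", OF \<psi> \<psi> isCont])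
      (auto intro!: continuous_intros)
  moreover have "Bochner_Integration.simple_bochner_integrable M (\<lambda>s. T (u i s))" for i
    using simple_bochner_integrable_compose2[OF _ u(1) u(1), of "\<lambda>x _. T x"] by (simp add: zero)
  ultimately show ?thesis
    unfolding has_strong_bochner_integral_def by (intro conjI allI exI[of _ "\<lambda>i s. T (u i s)"])
qed

lemma has_strong_bochner_integral_zero: "has_strong_bochner_integral M (\<lambda>_. 0) 0"
  using has_strong_bochner_integral_bounded_linear
    [OF has_bochner_integral_zero[where ?'b = real] bounded_linear_zero] .

lemma has_strong_bochner_integral_sum:
  "(\<And>i. i \<in> I \<Longrightarrow> has_strong_bochner_integral M (f i) (x i)) \<Longrightarrow>
    has_strong_bochner_integral M (\<lambda>s. \<Sum>i\<in>I. f i s) (\<Sum>i\<in>I. x i)"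
  by (induction I rule: infinite_finite_induct)
    (auto intro: has_strong_bochner_integral_add has_strong_bochner_integral_zero)

section \<open>Fatou's lemma and completeness of L1\<close>

lemma nn_integral_le_of_AE_LIMSEQ:
  fixes u :: "nat \<Rightarrow> 's \<Rightarrow> ennreal"
  assumes [measurable]: "\<And>j. u j \<in> borel_measurable M"
    and lim: "AE s in M. (\<lambda>j. u j s) \<longlonglongrightarrow> v s"
    and le: "\<forall>\<^sub>F j in sequentially. integral\<^sup>N M (u j) \<le> c"
  shows "integral\<^sup>N M v \<le> c"
proof -
  have "integral\<^sup>N M v = (\<integral>\<^sup>+s. liminf (\<lambda>j. u j s) \<partial>M)"
  proof (rule nn_integral_cong_AE)
    show "AE s in M. v s = liminf (\<lambda>j. u j s)"
      using lim by eventually_elim (simp add: lim_imp_Liminf)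
  qed
  also have "\<dots> \<le> liminf (\<lambda>j. integral\<^sup>N M (u j))"
    by (rule nn_integral_liminf) simp
  also have "\<dots> \<le> limsup (\<lambda>j. integral\<^sup>N M (u j))"
    by (rule Liminf_le_Limsup) simp
  also have "\<dots> \<le> c"
    by (rule Limsup_bounded[OF le])
  finally show ?thesis .
qed

text \<open>The increments form an absolutely convergent series in a Banach space, and its partial
  sums telescope.\<close>

lemma convergent_if_suminf_norm_diff_finite:
  fixes x :: "nat \<Rightarrow> 'x::banach"
  assumes "(\<Sum>j. ennreal (norm (x (Suc j) - x j))) \<noteq> \<infinity>"
  shows "convergent x"
proof -
  have "summable (\<lambda>j. norm (x (Suc j) - x j))"
    using assms by (intro summable_suminf_not_top) auto
  then have "summable (\<lambda>j. x (Suc j) - x j)"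
    by (rule summable_norm_cancel)
  then have "convergent (\<lambda>n. \<Sum>j<n. x (Suc j) - x j)"
    by (simp add: summable_iff_convergent)
  then have "convergent (\<lambda>n. (x n - x 0) + x 0)"
    by (intro convergent_add convergent_const) (simp add: sum_lessThan_telescope)
  then show ?thesis by simp
qed

text \<open>The Riesz-Fischer argument: a subsequence with L1 increments at most
  \<open>(1/2) ^ j\<close> has almost everywhere summable increments, hence converges almost
  everywhere. The subsequence is part of the result because Fatou's lemma is later applied along
  it.\<close>

lemma strongly_measurable_L1_complete:
  fixes F :: "nat \<Rightarrow> 's \<Rightarrow> 'x::banach"
  assumes F: "\<And>n. strongly_measurable M (F n)"
    and Cauchy: "\<And>e. e > 0 \<Longrightarrow>
      \<exists>N. \<forall>m\<ge>N. \<forall>n\<ge>N. (\<integral>\<^sup>+s. ennreal (norm (F m s - F n s)) \<partial>M) \<le> ennreal e"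
  obtains f r where "strongly_measurable M f" "AE s in M. (\<lambda>j. F (r j) s) \<longlonglongrightarrow> f s"
    "(\<lambda>n. \<integral>\<^sup>+s. ennreal (norm (f s - F n s)) \<partial>M) \<longlonglongrightarrow> 0"
proof -
  have [measurable]: "(\<lambda>s. norm (F m s - F n s)) \<in> borel_measurable M" for m n
    by (intro strongly_measurable_norm strongly_measurable_diff F)
  have "\<forall>j. \<exists>N. \<forall>m\<ge>N. \<forall>n\<ge>N.
      (\<integral>\<^sup>+s. ennreal (norm (F m s - F n s)) \<partial>M) \<le> ennreal ((1/2) ^ j)"
    using Cauchy by simp
  then obtain N where N: "\<And>j m n. m \<ge> N j \<Longrightarrow> n \<ge> N j \<Longrightarrow>
      (\<integral>\<^sup>+s. ennreal (norm (F m s - F n s)) \<partial>M) \<le> ennreal ((1/2) ^ j)"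
    by metis
  \<comment> \<open>Summing the thresholds makes both \<open>r j\<close> and
    \<open>r (Suc j)\<close> at least \<open>N j\<close>; the extra summand \<open>j\<close> sends
    \<open>r\<close> to infinity.\<close>
  define r where "r j = (\<Sum>i\<le>j. N i) + j" for j
  have r: "r j \<ge> N j" "r (Suc j) \<ge> N j" "r j \<ge> j" for j
    using member_le_sum[of j "{..j}" N] by (auto simp: r_def)
  define G where "G j s = ennreal (norm (F (r (Suc j)) s - F (r j) s))" for j s
  have [measurable]: "G j \<in> borel_measurable M" for j
    unfolding G_def by measurable
  have "(\<integral>\<^sup>+s. (\<Sum>j. G j s) \<partial>M) = (\<Sum>j. \<integral>\<^sup>+s. G j s \<partial>M)"
    by (rule nn_integral_suminf) simp
  also have "\<dots> \<le> (\<Sum>j. ennreal ((1/2) ^ j))"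
    unfolding G_def by (intro suminf_le N r) auto
  also have "\<dots> = ennreal (\<Sum>j. (1/2) ^ j)"
    by (intro suminf_ennreal2) (auto intro!: summable_geometric)
  finally have fin: "(\<integral>\<^sup>+s. (\<Sum>j. G j s) \<partial>M) \<noteq> \<infinity>"
    by (metis ennreal_less_top infinity_ennreal_def leD)
  \<comment> \<open>The null set on which the increments along the subsequence are not summable; the
    limit is set to 0 there.\<close>
  define Z where "Z = {s \<in> space M. (\<Sum>j. G j s) = \<infinity>}"
  have [measurable]: "Z \<in> sets M"
    unfolding Z_def by measurable
  have AE: "AE s in M. s \<notin> Z"
    using nn_integral_noteq_infinite[OF _ fin] by (auto simp: Z_def)
  define f where "f s = (if s \<in> Z then 0 else lim (\<lambda>j. F (r j) s))" for s
  have lim: "(\<lambda>j. F (r j) s) \<longlonglongrightarrow> f s" if "s \<in> space M - Z" for s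
  proof -
    have "convergent (\<lambda>j. F (r j) s)"
      using that by (intro convergent_if_suminf_norm_diff_finite) (auto simp: Z_def G_def)
    then show ?thesis
      using that by (simp add: f_def convergent_LIMSEQ_iff)
  qed
  have f: "strongly_measurable M f"
  proof (rule strongly_measurable_LIMSEQ)
    \<comment> \<open>Strong measurability passes to limits that exist at every point, so the
      subsequence is cut off to 0 on \<open>Z\<close>.\<close>
    show "strongly_measurable M (\<lambda>s. indicator (space M - Z) s *\<^sub>R F (r j) s)" for j
      by (intro strongly_measurable_scaleR strongly_measurable_simple F) auto
    show "(\<lambda>j. indicator (space M - Z) s *\<^sub>R F (r j) s) \<longlonglongrightarrow> f s" if "s \<in> space M" for s
      using that lim by (cases "s \<in> Z") (auto simp: f_def)
  qed
  have AE_lim: "AE s in M. (\<lambda>j. F (r j) s) \<longlonglongrightarrow> f s"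
    using AE lim by (auto elim!: AE_mp)
  have "(\<lambda>n. \<integral>\<^sup>+s. ennreal (norm (f s - F n s)) \<partial>M) \<longlonglongrightarrow> 0"
  proof (rule order_tendstoI)
    fix e :: ennreal assume "e > 0"
    \<comment> \<open>The Cauchy bounds are real numbers, while \<open>e\<close> may be
      infinite.\<close>
    then obtain e' :: real where e': "0 < e'" "ennreal e' < e"
      by (metis dense ennreal_cases ennreal_less_zero_iff ennreal_top_neq_zero linorder_not_le not_less_iff_gr_or_eq top.not_eq_extremum top_greatest)
    obtain N where N: "\<And>m n. m \<ge> N \<Longrightarrow> n \<ge> N \<Longrightarrow>
        (\<integral>\<^sup>+s. ennreal (norm (F m s - F n s)) \<partial>M) \<le> ennreal e'"
      using Cauchy[OF e'(1)] by blast
    have "(\<integral>\<^sup>+s. ennreal (norm (f s - F n s)) \<partial>M) \<le> ennreal e'" if "n \<ge> N" for n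
    \<comment> \<open>Fatou's lemma in the first index of the Cauchy bound:
      \<open>r j \<ge> j\<close> places \<open>r j\<close> beyond \<open>N\<close> eventually. This
      gives convergence of the whole sequence, not only of the subsequence.\<close>
    proof (rule nn_integral_le_of_AE_LIMSEQ)
      show "AE s in M. (\<lambda>j. ennreal (norm (F (r j) s - F n s))) \<longlonglongrightarrow> ennreal (norm (f s - F n s))"
        using AE_lim by eventually_elim (intro tendsto_intros)
      show "\<forall>\<^sub>F j in sequentially. (\<integral>\<^sup>+s. ennreal (norm (F (r j) s - F n s)) \<partial>M) \<le> ennreal e'"
        using eventually_ge_at_top[of N] by eventually_elim (use r(3) that in \<open>auto intro: N order_trans\<close>)
    qed measurable
    then show "\<forall>\<^sub>F n in sequentially. (\<integral>\<^sup>+s. ennreal (norm (f s - F n s)) \<partial>M) < e"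
      using e'(2) unfolding eventually_sequentially by (meson le_less_trans)
  qed simp
  with f AE_lim show ?thesis
    by (rule that)
qed

subsection \<open>Scalars and logarithmic weights\<close>

text \<open>Norms are taken in \<open>mult_scalar_conj\<close> and a factor \<open>norm x\<close> is
  cancelled. At 0, where cancellation fails, additivity of the conjugation gives the value.\<close>

lemma norm_scalar_conj: "norm (scalar_conj x) = norm x" for x :: "'k::rc_scalar"
proof (cases "x = 0")
  case True
  have "scalar_conj (0::'k) = 0"
    using scalar_conj_add[of "0::'k" 0] by simp
  then show ?thesis using True by simp
next
  case False
  have "norm x * norm (scalar_conj x) = norm x * norm x"
    using arg_cong[OF mult_scalar_conj[of x], of norm] by (simp add: norm_mult power2_eq_square)
  then show ?thesis using False by simp
qed

lemma scalar_conj_diff: "scalar_conj (x - y) = scalar_conj x - scalar_conj y" for x :: "'k::rc_scalar"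
  using scalar_conj_add[of "x - y" y] by (simp add: algebra_simps)

text \<open>Being additive and norm-preserving, conjugation is an isometry and so
  continuous.\<close>

lemma borel_measurable_scalar_conj [measurable]:
  "(scalar_conj :: 'k::rc_scalar \<Rightarrow> 'k) \<in> borel_measurable borel"
proof (rule borel_measurable_continuous_onI)
  show "continuous_on UNIV (scalar_conj :: 'k \<Rightarrow> 'k)"
    unfolding continuous_on_iff dist_norm by (metis norm_scalar_conj scalar_conj_diff)
qed

context banach_over
begin

lemma bounded_bilinear_smul: "bounded_bilinear smul"
proof
  show "smul (r *\<^sub>R a) x = r *\<^sub>R smul a x" for r a x
    by (simp add: scaleR_conv_of_real smul_of_real flip: scale_scale)
  show "smul a (r *\<^sub>R x) = r *\<^sub>R smul a x" for r a x
    by (simp add: mult.commute flip: smul_of_real)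
  show "\<exists>K. \<forall>a x. norm (smul a x) \<le> norm a * norm x * K"
    by (rule exI[of _ 1]) (simp add: norm_smul)
qed (simp_all add: scale_left_distrib scale_right_distrib)

lemma strongly_measurable_smul:
  "strongly_measurable M f \<Longrightarrow> strongly_measurable M g \<Longrightarrow> strongly_measurable M (\<lambda>s. smul (f s) (g s))"
  by (rule strongly_measurable_compose2[where h = smul])
    (auto intro!: bounded_bilinear.isCont[OF bounded_bilinear_smul] continuous_intros)

end

section \<open>Comparison of the logarithmic weight with powers of the norm\<close>

lemma log_plus_pos: "x \<ge> 0 \<Longrightarrow> log_plus x > 0"
  by (simp add: log_plus_def)

lemma log_weight_nonneg: "log_weight b x \<ge> 0"
  by (simp add: log_weight_def)

lemma norm_eq_log_weight: "norm x = log_weight b x * log_plus (1 / norm x) powr b"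
  using log_plus_pos[of "1 / norm x"] by (simp add: log_weight_def powr_minus)

text \<open>For norms at least 1 the logarithm is at most \<open>ln 3\<close>. Read
  contrapositively, a small weight forces norm below 1.\<close>

lemma log_weight_ge_of_norm_ge_1:
  assumes "norm x \<ge> 1" "b > 0"
  shows "log_weight b x \<ge> ln 3 powr (- b)"
proof -
  have "norm x > 0"
    using assms(1) by linarith
  then have "2 + 1 / norm x \<le> 3"
    using assms(1) by (simp add: divide_le_eq)
  moreover have "2 + 1 / norm x > 0"
    by (simp add: add_pos_nonneg)
  ultimately have "log_plus (1 / norm x) \<le> ln 3"
    unfolding log_plus_def by simp
  then have "ln 3 powr (- b) \<le> log_plus (1 / norm x) powr (- b)"
    using assms(2) log_plus_pos[of "1 / norm x"] by (intro powr_mono2') auto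
  also have "\<dots> \<le> norm x * log_plus (1 / norm x) powr (- b)"
    using assms(1) mult_right_mono[of 1 "norm x" "log_plus (1 / norm x) powr (- b)"] by simp
  finally show ?thesis by (simp add: log_weight_def)
qed

text \<open>Above the threshold \<open>exp (- m)\<close> the logarithm in the weight is at most
  \<open>ln (3 * exp m)\<close>, which grows only linearly in \<open>m\<close>. This serves the
  large coefficients.\<close>

lemma norm_le_log_weight:
  assumes x: "norm x > exp (- m)" and m: "m \<ge> 1" and b: "b > 0"
  shows "norm x \<le> (3 * m) powr b * log_weight b x"
proof -
  have pos: "norm x > 0"
    using x by (rule less_trans[rotated]) simp
  have "1 / norm x \<le> exp m"
    using x pos by (simp add: exp_minus field_simps)
  moreover have "1 \<le> exp m" using m by simp
  ultimately have "2 + 1 / norm x \<le> 3 * exp m" by linarith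
  then have "log_plus (1 / norm x) \<le> ln (3 * exp m)"
    unfolding log_plus_def using pos by (subst ln_le_cancel_iff) (auto intro: add_pos_pos)
  \<comment> \<open>\<open>ln 3 \<le> 2\<close> and \<open>m \<ge> 1\<close> give
    \<open>ln 3 + m \<le> 3 * m\<close>.\<close>
  also have "\<dots> \<le> 3 * m"
    using m ln_le_minus_one[of 3] by (simp add: ln_mult)
  finally have "log_plus (1 / norm x) powr b \<le> (3 * m) powr b"
    using b log_plus_pos[of "1 / norm x"] by (intro powr_mono2) auto
  from mult_right_mono[OF this log_weight_nonneg[of b x]] show ?thesis
    using norm_eq_log_weight[of x b] by (simp add: mult.commute)
qed

text \<open>Half of the surplus exponent \<open>p - 1\<close> absorbs the power of the logarithm.
  The other half is kept as a factor and supplies the exponential decay for coefficients below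
  \<open>exp (- m)\<close>.\<close>

lemma norm_powr_le_log_weight:
  assumes x: "norm x \<le> 1" and p: "p > 1" and b: "b > 0"
  shows "norm x powr p \<le>
    (3 powr ((p - 1) / 2) * (2 * b / (p - 1)) powr b) * norm x powr ((p - 1) / 2) * log_weight b x"
proof (cases "x = 0")
  case False
  define s where "s = norm x"
  \<comment> \<open>Chosen so that \<open>\<eta> * b = (p - 1) / 2\<close>: the bound of the
    logarithm by \<open>(3 / s) powr \<eta> / \<eta>\<close>, raised to the power \<open>b\<close>,
    costs exactly half of the surplus.\<close>
  define \<eta> where "\<eta> = (p - 1) / (2 * b)"
  have s: "s > 0" "s \<le> 1" using False x by (auto simp: s_def)
  have \<eta>: "\<eta> > 0" using p b by (simp add: \<eta>_def)
  define l where "l = log_plus (1 / s)"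
  have l: "l > 0" unfolding l_def using s by (intro log_plus_pos) auto
  have "l \<le> ln (3 / s)"
    unfolding l_def log_plus_def using s by (subst ln_le_cancel_iff) (auto simp: field_simps add_pos_pos)
  also have "\<dots> \<le> (3 / s) powr \<eta> / \<eta>"
    using s \<eta> by (intro ln_powr_bound) auto
  finally have "l powr b \<le> ((3 / s) powr \<eta> / \<eta>) powr b"
    using l b by (intro powr_mono2) auto
  also have "\<dots> = 3 powr (\<eta> * b) * s powr (- (\<eta> * b)) * (1 / \<eta>) powr b"
    using s \<eta> by (simp add: powr_divide powr_mult powr_powr powr_minus_divide)
  also have "\<eta> * b = (p - 1) / 2" using b by (simp add: \<eta>_def)
  also have "1 / \<eta> = 2 * b / (p - 1)" using b by (simp add: \<eta>_def)
  finally have le: "l powr b \<le> 3 powr ((p - 1) / 2) * s powr (- ((p - 1) / 2)) * (2 * b / (p - 1)) powr b"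
    by simp
  \<comment> \<open>One half power will cancel against the bound on \<open>l powr b\<close>, the
    other remains, and the single factor \<open>s\<close> joins \<open>l powr (- b)\<close> to form
    the weight.\<close>
  have "s powr p = s powr ((p - 1) / 2) * s powr ((p - 1) / 2) * s * (l powr b * l powr (- b))"
  proof -
    have "s powr ((p - 1) / 2) * s powr ((p - 1) / 2) * s = s powr ((p - 1) / 2 + (p - 1) / 2 + 1)"
      using s by (simp only: powr_add) simp
    also have "(p - 1) / 2 + (p - 1) / 2 + 1 = p" by (simp add: field_simps)
    finally show ?thesis using l by (simp add: powr_minus)
  qed
  also have "\<dots> = l powr b * (s powr ((p - 1) / 2) * s powr ((p - 1) / 2) * (s * l powr (- b)))"
    by (simp add: mult_ac)
  also have "\<dots> \<le> (3 powr ((p - 1) / 2) * s powr (- ((p - 1) / 2)) * (2 * b / (p - 1)) powr b) *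
      (s powr ((p - 1) / 2) * s powr ((p - 1) / 2) * (s * l powr (- b)))"
    using le s by (intro mult_right_mono) auto
  also have "\<dots> = (3 powr ((p - 1) / 2) * (2 * b / (p - 1)) powr b) *
      (s powr (- ((p - 1) / 2)) * s powr ((p - 1) / 2)) * s powr ((p - 1) / 2) * (s * l powr (- b))"
    by (simp only: mult_ac)
  also have "s powr (- ((p - 1) / 2)) * s powr ((p - 1) / 2) = 1"
    using s by (simp add: powr_minus)
  finally show ?thesis
    by (simp add: s_def l_def log_weight_def)
qed simp

text \<open>Summable weights tend to 0, so the norms are eventually at most 1; from there on the
  \<open>p\<close>-th powers are dominated by a multiple of the weights.\<close>

lemma summable_norm_powr_of_summable_log_weight:
  fixes c :: "nat \<Rightarrow> 'x::real_normed_vector"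
  assumes sum: "summable (\<lambda>n. log_weight b (c n))" and p: "p > 1" and b: "b > 0"
  shows "summable (\<lambda>n. norm (c n) powr p)"
proof -
  define E where "E = 3 powr ((p - 1) / 2) * (2 * b / (p - 1)) powr b"
  have "\<forall>\<^sub>F n in sequentially. log_weight b (c n) < ln 3 powr (- b)"
    by (rule order_tendstoD(2)[OF summable_LIMSEQ_zero[OF sum]]) simp
  then have "\<forall>\<^sub>F n in sequentially. norm (norm (c n) powr p) \<le> E * log_weight b (c n)"
  proof eventually_elim
    case (elim n)
    then have le: "norm (c n) \<le> 1"
      using log_weight_ge_of_norm_ge_1[of "c n" b] b by linarith
    have "norm (c n) powr p \<le> (E * log_weight b (c n)) * norm (c n) powr ((p - 1) / 2)"
      using norm_powr_le_log_weight[OF le p b] by (simp add: E_def mult_ac)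
    also have "\<dots> \<le> (E * log_weight b (c n)) * 1"
      using le p by (intro mult_left_mono powr_le1) (auto simp: E_def log_weight_nonneg)
    finally show ?case by simp
  qed
  then show ?thesis
    by (rule summable_comparison_test_ev) (intro summable_mult sum)
qed

text \<open>The space is cut into layers on which \<open>g\<close> varies by at most 1. The growth
  rate 1/4 of the integrand is half the decay rate 1/2 of the tail, so the layers contribute a
  convergent geometric series.\<close>

lemma (in prob_space) nn_integral_exp_le_of_tail_le:
  fixes g :: "'a \<Rightarrow> real"
  assumes [measurable]: "g \<in> borel_measurable M" and D: "D \<ge> 0"
    and tail: "\<And>m. m \<ge> 1 \<Longrightarrow> emeasure M {s \<in> space M. g s > real m} \<le> ennreal (D * exp (- real m / 2))"
  shows "(\<integral>\<^sup>+s. ennreal (exp (g s / 4)) \<partial>M) \<le> ennreal (exp (1 / 4) + D * (\<Sum>m. exp (- 1 / 4) ^ m))"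
proof -
  have geom: "summable (\<lambda>m. exp (- 1 / 4 :: real) ^ m)"
    by (intro summable_geometric) simp
  \<comment> \<open>The layer \<open>m + 1 < g s \<le> m + 2\<close> is majorized by the value at
    its upper end on the whole tail beyond its lower end.\<close>
  define h where "h m s = ennreal (exp ((real m + 2) / 4)) * indicator {s \<in> space M. g s > real (Suc m)} s"
    for m s
  have [measurable]: "h m \<in> borel_measurable M" for m
    unfolding h_def by measurable
  have pointwise: "ennreal (exp (g s / 4)) \<le> ennreal (exp (1 / 4)) + (\<Sum>m. h m s)" if s: "s \<in> space M" for s
  proof (cases "g s \<le> 1")
    case True
    then have "ennreal (exp (g s / 4)) \<le> ennreal (exp (1 / 4))"
      by (intro ennreal_leI) simp
    then show ?thesis by (rule order_trans) simp
  next
    case False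
    \<comment> \<open>The index of the layer containing \<open>g s\<close>; the ceiling is at least
      2 here, so truncation by \<open>nat\<close> changes nothing.\<close>
    define m where "m = nat (\<lceil>g s\<rceil> - 2)"
    have "\<lceil>g s\<rceil> \<ge> 2" using False by linarith
    then have m: "real m = real_of_int \<lceil>g s\<rceil> - 2" by (simp add: m_def)
    have "g s \<le> real m + 2" "real (Suc m) < g s"
      using m by simp_all linarith+
    then have "ennreal (exp (g s / 4)) \<le> h m s"
      using s by (auto simp: h_def intro!: ennreal_leI)
    also have "\<dots> \<le> (\<Sum>m. h m s)"
      using sum_le_suminf[of "\<lambda>m. h m s" "{m}"] by simp
    finally show ?thesis by (rule order_trans) simp
  qed
  have "(\<integral>\<^sup>+s. ennreal (exp (g s / 4)) \<partial>M) \<le> (\<integral>\<^sup>+s. ennreal (exp (1 / 4)) + (\<Sum>m. h m s) \<partial>M)"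
    by (intro nn_integral_mono pointwise)
  also have "\<dots> = ennreal (exp (1 / 4)) + (\<Sum>m. \<integral>\<^sup>+s. h m s \<partial>M)"
    by (simp add: nn_integral_add nn_integral_suminf emeasure_space_1)
  also have "\<dots> \<le> ennreal (exp (1 / 4)) + (\<Sum>m. ennreal (D * exp (- 1 / 4) ^ m))"
  proof (intro add_left_mono suminf_le)
    fix m
    have "(\<integral>\<^sup>+s. h m s \<partial>M) = ennreal (exp ((real m + 2) / 4)) * emeasure M {s \<in> space M. g s > real (Suc m)}"
      unfolding h_def by (rule nn_integral_cmult_indicator) measurable
    also have "\<dots> \<le> ennreal (exp ((real m + 2) / 4)) * ennreal (D * exp (- real (Suc m) / 2))"
      by (intro mult_left_mono tail) auto
    also have "\<dots> = ennreal (D * exp (- 1 / 4) ^ m)"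
    proof -
      have "exp ((real m + 2) / 4) * (D * exp (- real (Suc m) / 2)) =
          D * exp ((real m + 2) / 4 + - real (Suc m) / 2)"
        by (simp only: exp_add mult_ac)
      also have "(real m + 2) / 4 + - real (Suc m) / 2 = real m * (- 1 / 4)"
        by (simp add: field_simps)
      finally have "exp ((real m + 2) / 4) * (D * exp (- real (Suc m) / 2)) = D * exp (- 1 / 4) ^ m"
        by (simp only: exp_of_nat_mult)
      then show ?thesis
        by (metis ennreal_mult' exp_ge_zero)
    qed
    finally show "(\<integral>\<^sup>+s. h m s \<partial>M) \<le> ennreal (D * exp (- 1 / 4) ^ m)" .
  qed auto
  also have "(\<Sum>m. ennreal (D * exp (- 1 / 4) ^ m)) = ennreal (D * (\<Sum>m. exp (- 1 / 4) ^ m))"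
    using D geom by (subst suminf_ennreal2) (auto intro: summable_mult simp: suminf_mult)
  also have "ennreal (exp (1 / 4)) + \<dots> = ennreal (exp (1 / 4) + D * (\<Sum>m. exp (- 1 / 4) ^ m))"
    using D geom by (intro ennreal_plus[symmetric]) (auto intro!: mult_nonneg_nonneg suminf_nonneg)
  finally show ?thesis .
qed

subsection \<open>Fourier series in spaces of nontrivial type\<close>

text \<open>The bound of the system, the exponent and the type constant are fixed by name, so that
  all later constants are formed from them and do not depend on the coefficients. The exponents in
  \<open>type_bound\<close> keep the form they have in \<open>has_Phi_type\<close>.\<close>

locale Phi_type_system = prob_space M + banach_over smul
  for M :: "'s measure" and smul :: "'k::rc_scalar \<Rightarrow> 'x::banach \<Rightarrow> 'x" +
  fixes \<phi> :: "nat \<Rightarrow> 's \<Rightarrow> 'k" and K p C :: real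
  assumes orthonormal: "orthonormal_system M \<phi>"
    and norm_le: "\<And>n s. s \<in> space M \<Longrightarrow> norm (\<phi> n s) \<le> K"
    and p: "p > 1" and C: "C > 0"
    and type_bound: "\<And>n x. (\<integral>s. norm (\<Sum>k<n. smul (\<phi> k s) (x k)) powr (p / (p - 1)) \<partial>M) powr (1 / (p / (p - 1)))
        \<le> C * (\<Sum>k<n. norm (x k) powr p) powr (1 / p)"
begin

definition fourier_sum :: "(nat \<Rightarrow> 'x) \<Rightarrow> nat \<Rightarrow> 's \<Rightarrow> 'x" where
  "fourier_sum c n s = (\<Sum>k<n. smul (\<phi> k s) (c k))"

lemma K_nonneg: "K \<ge> 0"
  using not_empty norm_le norm_ge_zero order_trans by blast

lemma measurable_phi [measurable]: "\<phi> n \<in> borel_measurable M"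
  using orthonormal by (simp add: orthonormal_system_def)

lemma strongly_measurable_fourier_sum: "strongly_measurable M (fourier_sum c n)"
proof -
  have "strongly_measurable M (\<phi> k)" for k
    by (simp add: strongly_measurable_iff_borel_measurable)
  then have "strongly_measurable M (\<lambda>s. \<Sum>k<n. smul (\<phi> k s) (c k))"
    by (intro strongly_measurable_sum strongly_measurable_smul) (auto intro: strongly_measurable_simple)
  then show ?thesis
    unfolding fourier_sum_def[abs_def] .
qed

lemma norm_fourier_sum_le:
  assumes "s \<in> space M"
  shows "norm (fourier_sum c n s) \<le> K * (\<Sum>k<n. norm (c k))"
  unfolding fourier_sum_def sum_distrib_left
  by (intro sum_norm_le) (auto simp: norm_smul intro!: mult_right_mono norm_le assms)

text \<open>The type inequality raised to the power \<open>q = p / (p - 1)\<close>, where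
  \<open>q / p = 1 / (p - 1)\<close>.\<close>

lemma nn_integral_fourier_sum_le:
  "(\<integral>\<^sup>+s. ennreal (norm (fourier_sum c n s) powr (p / (p - 1))) \<partial>M)
    \<le> ennreal (C powr (p / (p - 1)) * (\<Sum>k<n. norm (c k) powr p) powr (1 / (p - 1)))"
proof -
  define q where "q = p / (p - 1)"
  have q: "q > 0" using p by (simp add: q_def)
  define h where "h s = norm (fourier_sum c n s) powr q" for s
  have [measurable]: "(\<lambda>s. norm (fourier_sum c n s)) \<in> borel_measurable M"
    by (intro strongly_measurable_norm strongly_measurable_fourier_sum)
  \<comment> \<open>Integrability, from the uniform bound on the system, lets the real integral in
    \<open>type_bound\<close> be exchanged for the nonnegative one.\<close>
  have int: "integrable M h"
  proof (rule integrable_const_bound)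
    show "AE s in M. norm (h s) \<le> (K * (\<Sum>k<n. norm (c k))) powr q"
      using q norm_fourier_sum_le by (auto simp: h_def intro!: powr_mono2)
  qed (simp add: h_def[abs_def])
  define I where "I = (\<integral>s. h s \<partial>M)"
  have I: "I \<ge> 0" unfolding I_def by (intro integral_nonneg_AE) (simp add: h_def)
  have "I = (I powr (1 / q)) powr q"
    using I q by (simp add: powr_powr)
  also have "\<dots> \<le> (C * (\<Sum>k<n. norm (c k) powr p) powr (1 / p)) powr q"
    using type_bound[where n = n and x = c] q
    by (intro powr_mono2) (auto simp: I_def h_def fourier_sum_def q_def)
  also have "\<dots> = C powr q * (\<Sum>k<n. norm (c k) powr p) powr (1 / p * q)"
    using C by (simp add: powr_mult powr_powr sum_nonneg)
  also have "1 / p * q = 1 / (p - 1)"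
    using p by (simp add: q_def)
  finally have le: "I \<le> C powr q * (\<Sum>k<n. norm (c k) powr p) powr (1 / (p - 1))" .
  have "(\<integral>\<^sup>+s. ennreal (h s) \<partial>M) = ennreal I"
    unfolding I_def by (rule nn_integral_eq_integral[OF int]) (simp add: h_def)
  with le show ?thesis
    unfolding h_def q_def by (simp add: ennreal_leI)
qed

text \<open>Zeroing the first \<open>n\<close> coefficients presents a block of the series as a
  partial sum, so that the type inequality applies to it.\<close>

lemma fourier_sum_diff:
  assumes "n \<le> m"
  shows "fourier_sum c m s - fourier_sum c n s = fourier_sum (\<lambda>k. if k < n then 0 else c k) m s"
proof -
  have "fourier_sum (\<lambda>k. if k < n then 0 else c k) m s = (\<Sum>k\<in>{..<m} - {..<n}. smul (\<phi> k s) (c k))"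
    unfolding fourier_sum_def by (rule sum.mono_neutral_cong_right) auto
  also have "\<dots> = fourier_sum c m s - fourier_sum c n s"
    unfolding fourier_sum_def using assms by (intro sum_diff) auto
  finally show ?thesis by simp
qed

lemma fourier_sum_Cauchy:
  assumes sum: "summable (\<lambda>n. norm (c n) powr p)" and e: "e > 0"
  shows "\<exists>N. \<forall>m\<ge>N. \<forall>n\<ge>N. (\<integral>\<^sup>+s. ennreal (norm (fourier_sum c m s - fourier_sum c n s)) \<partial>M) \<le> ennreal e"
proof -
  define q where "q = p / (p - 1)"
  define \<epsilon> where "\<epsilon> = e / 2"
  have \<epsilon>: "\<epsilon> > 0" using e by (simp add: \<epsilon>_def)
  have q: "q > 1" using p by (simp add: q_def)
  \<comment> \<open>Solves \<open>C powr q * \<tau> powr (1 / (p - 1)) = \<epsilon> powr q\<close>,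
    so that the type inequality bounds the integral of \<open>h s powr q\<close> by
    \<open>\<epsilon> powr q\<close>.\<close>
  define \<tau> where "\<tau> = (\<epsilon> powr q / C powr q) powr (p - 1)"
  have "\<tau> > 0" using \<epsilon> C by (simp add: \<tau>_def)
  then obtain N where N: "\<And>m n. n \<ge> N \<Longrightarrow> norm (\<Sum>k\<in>{n..<m}. norm (c k) powr p) < \<tau>"
    using sum unfolding summable_Cauchy by blast
  have *: "(\<integral>\<^sup>+s. ennreal (norm (fourier_sum c m s - fourier_sum c n s)) \<partial>M) \<le> ennreal e"
    if "N \<le> n" "n \<le> m" for m n
  proof -
    define y where "y k = (if k < n then 0 else c k)" for k
    define h where "h s = norm (fourier_sum y m s)" for s
    have [measurable]: "h \<in> borel_measurable M"
      unfolding h_def[abs_def] by (intro strongly_measurable_norm strongly_measurable_fourier_sum)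
    have "(\<Sum>k<m. norm (y k) powr p) = (\<Sum>k\<in>{n..<m}. norm (c k) powr p)"
      by (rule sum.mono_neutral_cong_right) (auto simp: y_def)
    then have "(\<Sum>k<m. norm (y k) powr p) \<le> \<tau>"
      using N[OF that(1), of m] by simp
    then have "(\<Sum>k<m. norm (y k) powr p) powr (1 / (p - 1)) \<le> \<tau> powr (1 / (p - 1))"
      using p by (intro powr_mono2) (auto simp: sum_nonneg)
    also have "\<dots> = \<epsilon> powr q / C powr q"
      using p C by (simp add: \<tau>_def powr_powr)
    finally have "C powr q * (\<Sum>k<m. norm (y k) powr p) powr (1 / (p - 1)) \<le> \<epsilon> powr q"
      using C by (simp add: field_simps)
    then have hq: "(\<integral>\<^sup>+s. ennreal (h s powr q) \<partial>M) \<le> ennreal (\<epsilon> powr q)"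
      using nn_integral_fourier_sum_le[of y m] unfolding h_def q_def
      by (meson ennreal_leI order_trans)
    \<comment> \<open>An elementary substitute for Hoelder's inequality: beyond
      \<open>\<epsilon>\<close>, the factor \<open>h s powr (1 - q)\<close> is at most
      \<open>\<epsilon> powr (1 - q)\<close> because \<open>q > 1\<close>. Integration over the
      probability space yields \<open>2 * \<epsilon> = e\<close>.\<close>
    have young: "h s \<le> \<epsilon> + \<epsilon> powr (1 - q) * h s powr q" for s
    proof (cases "h s \<le> \<epsilon>")
      case True
      then show ?thesis by (intro add_increasing2) auto
    next
      case False
      then have "h s = h s powr (1 - q) * h s powr q"
        using \<epsilon> by (simp flip: powr_add)
      also have "\<dots> \<le> \<epsilon> powr (1 - q) * h s powr q"
        using False \<epsilon> q by (intro mult_right_mono powr_mono2') auto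
      finally show ?thesis using \<epsilon> by simp
    qed
    have "(\<integral>\<^sup>+s. ennreal (norm (fourier_sum c m s - fourier_sum c n s)) \<partial>M) = (\<integral>\<^sup>+s. ennreal (h s) \<partial>M)"
      unfolding h_def y_def fourier_sum_diff[OF that(2)] ..
    also have "\<dots> \<le> (\<integral>\<^sup>+s. ennreal \<epsilon> + ennreal (\<epsilon> powr (1 - q)) * ennreal (h s powr q) \<partial>M)"
      using young \<epsilon> by (intro nn_integral_mono) (simp flip: ennreal_mult ennreal_plus add: ennreal_leI)
    also have "\<dots> = ennreal \<epsilon> + ennreal (\<epsilon> powr (1 - q)) * (\<integral>\<^sup>+s. ennreal (h s powr q) \<partial>M)"
      by (simp add: nn_integral_add nn_integral_cmult emeasure_space_1)
    also have "\<dots> \<le> ennreal \<epsilon> + ennreal (\<epsilon> powr (1 - q)) * ennreal (\<epsilon> powr q)"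
      by (intro add_left_mono mult_left_mono hq) auto
    also have "\<dots> = ennreal (\<epsilon> + \<epsilon> powr (1 - q) * \<epsilon> powr q)"
      using \<epsilon> by (simp flip: ennreal_mult ennreal_plus)
    also have "\<epsilon> + \<epsilon> powr (1 - q) * \<epsilon> powr q = e"
      using \<epsilon> by (simp add: \<epsilon>_def flip: powr_add)
    finally show ?thesis .
  qed
  show ?thesis
  proof (intro exI allI impI)
    fix m n assume "m \<ge> N" "n \<ge> N"
    then show "(\<integral>\<^sup>+s. ennreal (norm (fourier_sum c m s - fourier_sum c n s)) \<partial>M) \<le> ennreal e"
      using *[of n m] *[of m n] by (cases "n \<le> m") (simp_all add: norm_minus_commute)
  qed
qed

section \<open>Fourier coefficients and the limit function\<close>

lemma fourier_coeff_fourier_sum: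
  "has_strong_bochner_integral M (\<lambda>s. smul (scalar_conj (\<phi> n s)) (fourier_sum c m s))
    (if n < m then c n else 0)"
proof -
  have norm_conj: "norm (\<phi> k s * scalar_conj (\<phi> n s)) \<le> K * K" if "s \<in> space M" for k s
    using that K_nonneg by (auto simp: norm_mult norm_scalar_conj intro!: mult_mono norm_le)
  have "has_bochner_integral M (\<lambda>s. \<phi> k s * scalar_conj (\<phi> n s)) (if k = n then 1 else 0)" for k
  proof -
    \<comment> \<open>Orthonormality gives only the value of the integral, which is 0 by default for
      a nonintegrable function; boundedness gives integrability.\<close>
    have "integrable M (\<lambda>s. \<phi> k s * scalar_conj (\<phi> n s))"
      by (rule integrable_const_bound[of _ "K * K"]) (auto intro: norm_conj)
    moreover have "(\<integral>s. \<phi> k s * scalar_conj (\<phi> n s) \<partial>M) = (if k = n then 1 else 0)"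
      using orthonormal by (simp add: orthonormal_system_def)
    ultimately show ?thesis
      by (simp add: has_bochner_integral_iff)
  qed
  then have "has_strong_bochner_integral M (\<lambda>s. smul (\<phi> k s * scalar_conj (\<phi> n s)) (c k))
      (smul (if k = n then 1 else 0) (c k))" for k
    by (rule has_strong_bochner_integral_bounded_linear)
      (rule bounded_bilinear.bounded_linear_left[OF bounded_bilinear_smul])
  then have "has_strong_bochner_integral M (\<lambda>s. \<Sum>k<m. smul (\<phi> k s * scalar_conj (\<phi> n s)) (c k))
      (\<Sum>k<m. smul (if k = n then 1 else 0) (c k))"
    by (rule has_strong_bochner_integral_sum)
  moreover have "(\<Sum>k<m. smul (if k = n then 1 else 0) (c k)) = (\<Sum>k<m. if k = n then c k else 0)"
    by (intro sum.cong) auto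
  moreover have "(\<lambda>s. \<Sum>k<m. smul (\<phi> k s * scalar_conj (\<phi> n s)) (c k)) =
      (\<lambda>s. smul (scalar_conj (\<phi> n s)) (fourier_sum c m s))"
    by (simp add: fourier_sum_def scale_sum_right mult.commute)
  ultimately show ?thesis
    by (simp add: sum.delta)
qed

text \<open>The partial sums converge in L1, and taking a coefficient is continuous in L1 because
  the system is bounded.\<close>

lemma exists_fourier_series:
  assumes "summable (\<lambda>n. norm (c n) powr p)"
  obtains f r where "bochner_L1 M f" "\<And>n. has_fourier_coeff M smul \<phi> f n (c n)"
    "AE s in M. (\<lambda>j. fourier_sum c (r j) s) \<longlonglongrightarrow> f s"
proof -
  obtain f r where f: "strongly_measurable M f"
    and AE: "AE s in M. (\<lambda>j. fourier_sum c (r j) s) \<longlonglongrightarrow> f s"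
    and lim: "(\<lambda>n. \<integral>\<^sup>+s. ennreal (norm (f s - fourier_sum c n s)) \<partial>M) \<longlonglongrightarrow> 0"
    using strongly_measurable_L1_complete[OF strongly_measurable_fourier_sum[of c] fourier_sum_Cauchy[OF assms]]
    by blast
  note [measurable] = strongly_measurable_norm[OF strongly_measurable_fourier_sum]
    strongly_measurable_norm[OF strongly_measurable_diff[OF f strongly_measurable_fourier_sum]]
  have "bochner_L1 M f"
  proof -
    have "\<forall>\<^sub>F n in sequentially. (\<integral>\<^sup>+s. ennreal (norm (f s - fourier_sum c n s)) \<partial>M) < 1"
      by (rule order_tendstoD(2)[OF lim]) simp
    \<comment> \<open>One partial sum at L1 distance less than 1 from \<open>f\<close> suffices,
      since it is a bounded function on a probability space.\<close>
    then obtain n where n: "(\<integral>\<^sup>+s. ennreal (norm (f s - fourier_sum c n s)) \<partial>M) < 1"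
      unfolding eventually_sequentially by blast
    have "(\<integral>\<^sup>+s. ennreal (norm (f s)) \<partial>M)
        \<le> (\<integral>\<^sup>+s. ennreal (norm (f s - fourier_sum c n s)) + ennreal (K * (\<Sum>k<n. norm (c k))) \<partial>M)"
    proof (rule nn_integral_mono)
      fix s assume "s \<in> space M"
      then have "norm (f s) \<le> norm (f s - fourier_sum c n s) + K * (\<Sum>k<n. norm (c k))"
        using norm_triangle_sub[of "f s" "fourier_sum c n s"] norm_fourier_sum_le[of s c n] by linarith
      moreover have "K * (\<Sum>k<n. norm (c k)) \<ge> 0"
        by (intro mult_nonneg_nonneg K_nonneg sum_nonneg) auto
      ultimately show "ennreal (norm (f s))
          \<le> ennreal (norm (f s - fourier_sum c n s)) + ennreal (K * (\<Sum>k<n. norm (c k)))"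
        by (simp flip: ennreal_plus add: ennreal_leI)
    qed
    also have "\<dots> = (\<integral>\<^sup>+s. ennreal (norm (f s - fourier_sum c n s)) \<partial>M) + ennreal (K * (\<Sum>k<n. norm (c k)))"
      by (simp add: nn_integral_add emeasure_space_1)
    also have "\<dots> < \<infinity>"
      using n by (simp add: less_top[symmetric] top_unique) (metis ennreal_one_less_top order.strict_trans less_irrefl)
    finally show ?thesis
      using f by (simp add: bochner_L1_def)
  qed
  moreover have "has_fourier_coeff M smul \<phi> f n (c n)" for n
    unfolding has_fourier_coeff_def
  \<comment> \<open>The \<open>n\<close>-th coefficient of the \<open>m\<close>-th partial sum
    equals \<open>c n\<close> as soon as \<open>m > n\<close>, so the limit of the coefficients is
    \<open>c n\<close>.\<close>
  proof (rule has_strong_bochner_integral_LIMSEQ[OF fourier_coeff_fourier_sum])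
    show "strongly_measurable M (\<lambda>s. smul (scalar_conj (\<phi> n s)) (f s))"
      by (intro strongly_measurable_smul f) (simp add: strongly_measurable_iff_borel_measurable)
    show "(\<lambda>m. \<integral>\<^sup>+s. ennreal (norm (smul (scalar_conj (\<phi> n s)) (f s) -
        smul (scalar_conj (\<phi> n s)) (fourier_sum c m s))) \<partial>M) \<longlonglongrightarrow> 0"
    proof (rule tendsto_sandwich[OF _ _ tendsto_const])
      have "(\<integral>\<^sup>+s. ennreal (norm (smul (scalar_conj (\<phi> n s)) (f s) -
          smul (scalar_conj (\<phi> n s)) (fourier_sum c m s))) \<partial>M)
          \<le> (\<integral>\<^sup>+s. ennreal K * ennreal (norm (f s - fourier_sum c m s)) \<partial>M)" for m
        by (intro nn_integral_mono)
          (auto simp: norm_smul norm_scalar_conj K_nonneg intro!: ennreal_leI mult_right_mono norm_le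
            simp flip: scale_right_diff_distrib ennreal_mult)
      then show "\<forall>\<^sub>F m in sequentially. (\<integral>\<^sup>+s. ennreal (norm (smul (scalar_conj (\<phi> n s)) (f s) -
          smul (scalar_conj (\<phi> n s)) (fourier_sum c m s))) \<partial>M)
          \<le> ennreal K * (\<integral>\<^sup>+s. ennreal (norm (f s - fourier_sum c m s)) \<partial>M)"
        by (simp add: nn_integral_cmult)
      show "(\<lambda>m. ennreal K * (\<integral>\<^sup>+s. ennreal (norm (f s - fourier_sum c m s)) \<partial>M)) \<longlonglongrightarrow> 0"
        using ennreal_tendsto_cmult[OF _ lim, of "ennreal K"] by simp
    qed auto
    have "\<forall>\<^sub>F m in sequentially. (if n < m then c n else 0) = c n"
      using eventually_gt_at_top[of n] by eventually_elim simp
    then show "(\<lambda>m. if n < m then c n else 0) \<longlonglongrightarrow> c n"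
      by (rule tendsto_eventually)
  qed
  ultimately show ?thesis
    using that AE by blast
qed

section \<open>Tail estimate and exponential integrability of the partial sums\<close>

lemma emeasure_fourier_sum_tail:
  assumes b: "b > 0" and \<rho>: "\<rho> > 0" and le: "(\<Sum>k<n. log_weight b (c k)) \<le> \<rho>" and m: "m \<ge> 1"
    and E: "E = 3 powr ((p - 1) / 2) * (2 * b / (p - 1)) powr b"
  shows "emeasure M {s \<in> space M. norm (fourier_sum c n s) > (K * \<rho> * 3 powr b + 1) * m powr b}
    \<le> ennreal (C powr (p / (p - 1)) * (E * \<rho>) powr (1 / (p - 1)) * exp (- m / 2))"
proof -
  define q where "q = p / (p - 1)"
  have q: "q > 0" using p by (simp add: q_def)
  have E0: "E \<ge> 0" by (simp add: E)
  \<comment> \<open>Small and large coefficients are separated at \<open>exp (- m)\<close>: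
    \<open>z\<close> is estimated pointwise by the sum of its norms, \<open>y\<close> through the
    type inequality.\<close>
  define y where "y k = (if norm (c k) > exp (- m) then 0 else c k)" for k
  define z where "z k = (if norm (c k) > exp (- m) then c k else 0)" for k
  have split: "fourier_sum c n s = fourier_sum z n s + fourier_sum y n s" for s
    unfolding fourier_sum_def sum.distrib[symmetric] by (intro sum.cong) (auto simp: y_def z_def)
  have "(\<Sum>k<n. norm (z k)) \<le> (\<Sum>k<n. (3 * m) powr b * log_weight b (c k))"
    using norm_le_log_weight[OF _ m b] by (intro sum_mono) (auto simp: z_def log_weight_nonneg)
  also have "\<dots> \<le> (3 * m) powr b * \<rho>"
    unfolding sum_distrib_left[symmetric] using le by (intro mult_left_mono) auto
  finally have "K * (\<Sum>k<n. norm (z k)) \<le> K * ((3 * m) powr b * \<rho>)"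
    by (intro mult_left_mono K_nonneg)
  then have z: "norm (fourier_sum z n s) \<le> K * \<rho> * 3 powr b * m powr b" if "s \<in> space M" for s
    using norm_fourier_sum_le[OF that, of z n] m by (simp add: powr_mult mult_ac)
  have "(\<Sum>k<n. norm (y k) powr p) \<le> (\<Sum>k<n. E * exp (- m * ((p - 1) / 2)) * log_weight b (c k))"
  proof (intro sum_mono)
    fix k
    show "norm (y k) powr p \<le> E * exp (- m * ((p - 1) / 2)) * log_weight b (c k)"
    proof (cases "norm (c k) > exp (- m)")
      case True
      then show ?thesis by (simp add: y_def log_weight_nonneg E0)
    next
      case False
      then have "norm (c k) \<le> exp (- m)" by simp
      also have "\<dots> \<le> 1" using m by simp
      finally have "norm (c k) powr p \<le> E * norm (c k) powr ((p - 1) / 2) * log_weight b (c k)"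
        unfolding E by (rule norm_powr_le_log_weight[OF _ p b])
      \<comment> \<open>The half power kept in reserve is where the threshold produces exponential
        smallness.\<close>
      also have "\<dots> \<le> E * exp (- m) powr ((p - 1) / 2) * log_weight b (c k)"
        using False p E0 by (intro mult_right_mono mult_left_mono powr_mono2) (auto simp: log_weight_nonneg)
      finally show ?thesis
        using False by (simp add: y_def exp_powr_real)
    qed
  qed
  also have "\<dots> \<le> E * exp (- m * ((p - 1) / 2)) * \<rho>"
    unfolding sum_distrib_left[symmetric] using le E0 by (intro mult_left_mono) auto
  finally have "(\<Sum>k<n. norm (y k) powr p) powr (1 / (p - 1)) \<le>
      (E * \<rho> * exp (- m * ((p - 1) / 2))) powr (1 / (p - 1))"
    using p by (intro powr_mono2) (auto simp: sum_nonneg mult_ac)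
  also have "\<dots> = (E * \<rho>) powr (1 / (p - 1)) * exp (- m * ((p - 1) / 2) * (1 / (p - 1)))"
    using E0 \<rho> by (simp add: powr_mult exp_powr_real)
  \<comment> \<open>The outer power \<open>1 / (p - 1)\<close> makes the decay rate 1/2 for every
    \<open>p\<close>.\<close>
  also have "- m * ((p - 1) / 2) * (1 / (p - 1)) = - m / 2"
    using p by (simp add: field_simps)
  finally have y: "(\<Sum>k<n. norm (y k) powr p) powr (1 / (p - 1)) \<le> (E * \<rho>) powr (1 / (p - 1)) * exp (- m / 2)" .
  have [measurable]: "(\<lambda>s. norm (fourier_sum c n s)) \<in> borel_measurable M" for c
    by (intro strongly_measurable_norm strongly_measurable_fourier_sum)
  let ?A = "{s \<in> space M. norm (fourier_sum c n s) > (K * \<rho> * 3 powr b + 1) * m powr b}"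
  have "emeasure M ?A = (\<integral>\<^sup>+s. indicator ?A s \<partial>M)"
    by (rule nn_integral_indicator[symmetric]) measurable
  also have "\<dots> \<le> (\<integral>\<^sup>+s. ennreal (norm (fourier_sum y n s) powr q) \<partial>M)"
  proof (rule nn_integral_mono)
    fix s assume s: "s \<in> space M"
    show "indicator ?A s \<le> ennreal (norm (fourier_sum y n s) powr q)"
    proof (cases "s \<in> ?A")
      \<comment> \<open>The large part uses up at most
        \<open>K * \<rho> * 3 powr b * m powr b\<close>. The remaining
        \<open>m powr b \<ge> 1\<close> must come from the small part, and Chebyshev with exponent
        \<open>q\<close> applies at level 1.\<close>
      case True
      have "1 \<le> m powr b" using m b by (simp add: ge_one_powr_ge_zero)
      then have "1 \<le> norm (fourier_sum y n s)"
        using True z[OF s] norm_triangle_ineq[of "fourier_sum z n s" "fourier_sum y n s"]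
        unfolding split by (simp add: algebra_simps)
      then have "1 \<le> norm (fourier_sum y n s) powr q"
        using q by (intro ge_one_powr_ge_zero) auto
      then show ?thesis using True by simp
    qed simp
  qed
  also have "\<dots> \<le> ennreal (C powr q * (\<Sum>k<n. norm (y k) powr p) powr (1 / (p - 1)))"
    unfolding q_def by (rule nn_integral_fourier_sum_le)
  also have "\<dots> \<le> ennreal (C powr q * ((E * \<rho>) powr (1 / (p - 1)) * exp (- m / 2)))"
    using y by (intro ennreal_leI mult_left_mono) auto
  finally show ?thesis
    by (simp add: q_def mult.assoc)
qed

lemma exp_integrability_fourier_sum:
  assumes b: "b > 0" and \<rho>: "\<rho> > 0"
  shows "\<exists>a>0. \<exists>A>0. \<forall>c n. (\<Sum>k<n. log_weight b (c k)) \<le> \<rho> \<longrightarrow>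
    (\<integral>\<^sup>+s. ennreal (exp (a * norm (fourier_sum c n s) powr (1 / b))) \<partial>M) \<le> ennreal A"
proof -
  define L where "L = K * \<rho> * 3 powr b + 1"
  have L: "L > 0" unfolding L_def using K_nonneg \<rho> by (intro add_nonneg_pos mult_nonneg_nonneg) auto
  define D where "D = C powr (p / (p - 1)) *
    ((3 powr ((p - 1) / 2) * (2 * b / (p - 1)) powr b) * \<rho>) powr (1 / (p - 1))"
  have D: "D \<ge> 0" by (simp add: D_def)
  \<comment> \<open>The rescaled function \<open>g\<close> below exceeds \<open>m\<close> only if
    the partial sum exceeds \<open>L * m powr b\<close>. This \<open>a\<close> satisfies
    \<open>g s / 4 = a * norm (fourier_sum c n s) powr (1 / b)\<close>, matching the rate 1/4 of the
    integration lemma.\<close>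
  define a where "a = L powr (- (1 / b)) / 4"
  define A where "A = exp (1 / 4) + D * (\<Sum>m. exp (- 1 / 4 :: real) ^ m)"
  have "a > 0" using L by (simp add: a_def)
  moreover have "A > 0"
    unfolding A_def using D
    by (intro add_pos_nonneg mult_nonneg_nonneg suminf_nonneg summable_geometric) auto
  moreover have "(\<integral>\<^sup>+s. ennreal (exp (a * norm (fourier_sum c n s) powr (1 / b))) \<partial>M) \<le> ennreal A"
    if le: "(\<Sum>k<n. log_weight b (c k)) \<le> \<rho>" for c n
  proof -
    define g where "g s = (norm (fourier_sum c n s) / L) powr (1 / b)" for s
    have [measurable]: "(\<lambda>s. norm (fourier_sum c n s)) \<in> borel_measurable M"
      by (intro strongly_measurable_norm strongly_measurable_fourier_sum)
    have gm: "g \<in> borel_measurable M"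
      unfolding g_def[abs_def] by measurable
    have "(\<integral>\<^sup>+s. ennreal (exp (g s / 4)) \<partial>M) \<le> ennreal A"
      unfolding A_def
    proof (rule nn_integral_exp_le_of_tail_le[OF gm D])
      fix m :: nat assume m: "m \<ge> 1"
      have "norm (fourier_sum c n s) > L * real m powr b" if "g s > real m" for s
      proof -
        have "real m powr b < g s powr b"
          using that b by (intro powr_less_mono2) auto
        also have "\<dots> = norm (fourier_sum c n s) / L"
          using b L by (simp add: g_def powr_powr)
        finally show ?thesis using L by (simp add: field_simps)
      qed
      then have "emeasure M {s \<in> space M. g s > real m}
          \<le> emeasure M {s \<in> space M. norm (fourier_sum c n s) > L * real m powr b}"
        by (intro emeasure_mono) auto
      also have "\<dots> \<le> ennreal (D * exp (- real m / 2))"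
        unfolding L_def D_def by (rule emeasure_fourier_sum_tail[OF b \<rho> le _ refl]) (use m in simp)
      finally show "emeasure M {s \<in> space M. g s > real m} \<le> ennreal (D * exp (- real m / 2))" .
    qed
    moreover have "g s / 4 = a * norm (fourier_sum c n s) powr (1 / b)" for s
      using L by (simp add: g_def a_def powr_divide powr_minus_divide)
    ultimately show ?thesis by simp
  qed
  ultimately show ?thesis by blast
qed

end

theorem corollary7p19:
  fixes M :: "'s measure"
    and smul :: "'k::rc_scalar \<Rightarrow> 'x::banach \<Rightarrow> 'x"
    and \<phi> :: "nat \<Rightarrow> 's \<Rightarrow> 'k"
    and b \<rho> :: real
  assumes "emeasure M (space M) = 1"
    and "orthonormal_system M \<phi>"
    and "uniformly_bounded_system M \<phi>"
    and "banach_over smul"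
    and "nontrivial_Phi_type M smul \<phi>"
    and "b > 0"
    and "\<rho> > 0"
  shows "\<exists>a>0. \<exists>A>0. \<forall>c :: nat \<Rightarrow> 'x.
    summable (\<lambda>n. log_weight b (c n)) \<and> (\<Sum>n. log_weight b (c n)) \<le> \<rho> \<longrightarrow>
    (\<exists>f. bochner_L1 M f \<and>
         (\<forall>n. has_fourier_coeff M smul \<phi> f n (c n)) \<and>
         (\<integral>\<^sup>+s. ennreal (exp (a * norm (f s) powr (1 / b))) \<partial>M) \<le> ennreal A)"
proof -
  obtain K where K: "\<And>n s. s \<in> space M \<Longrightarrow> norm (\<phi> n s) \<le> K"
    using assms(3) unfolding uniformly_bounded_system_def by blast
  obtain p where p: "1 < p" "has_Phi_type M smul \<phi> p"
    using assms(5) unfolding nontrivial_Phi_type_def by blast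
  \<comment> \<open>Since \<open>p > 1\<close>, the definition of type reduces to its integral
    form.\<close>
  then obtain C where C: "C > 0" and type: "\<And>n x.
      (\<integral>s. norm (\<Sum>k<n. smul (\<phi> k s) (x k)) powr (p / (p - 1)) \<partial>M) powr (1 / (p / (p - 1)))
        \<le> C * (\<Sum>k<n. norm (x k) powr p) powr (1 / p)"
    unfolding has_Phi_type_def by (auto simp: Let_def)
  interpret prob_space M
    by (rule prob_spaceI) fact
  interpret banach_over smul by fact
  interpret Phi_type_system M smul \<phi> K p C
    by unfold_locales (use assms(2) K p C type in auto)
  \<comment> \<open>Both constants are obtained before any sequence is fixed, and they serve all
    partial sums at once.\<close>
  obtain a A where "a > 0" "A > 0" and exp_le: "\<And>c n. (\<Sum>k<n. log_weight b (c k)) \<le> \<rho> \<Longrightarrow>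
      (\<integral>\<^sup>+s. ennreal (exp (a * norm (fourier_sum c n s) powr (1 / b))) \<partial>M) \<le> ennreal A"
    using exp_integrability_fourier_sum[OF \<open>b > 0\<close> \<open>\<rho> > 0\<close>] by blast
  have "\<exists>f. bochner_L1 M f \<and> (\<forall>n. has_fourier_coeff M smul \<phi> f n (c n)) \<and>
      (\<integral>\<^sup>+s. ennreal (exp (a * norm (f s) powr (1 / b))) \<partial>M) \<le> ennreal A"
    if sum: "summable (\<lambda>n. log_weight b (c n))" and le: "(\<Sum>n. log_weight b (c n)) \<le> \<rho>" for c
  proof -
    obtain f r where f: "bochner_L1 M f" "\<And>n. has_fourier_coeff M smul \<phi> f n (c n)"
      and lim: "AE s in M. (\<lambda>j. fourier_sum c (r j) s) \<longlonglongrightarrow> f s"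
      using exists_fourier_series[OF summable_norm_powr_of_summable_log_weight[OF sum p(1) \<open>b > 0\<close>]]
      by blast
    have "(\<Sum>k<n. log_weight b (c k)) \<le> \<rho>" for n
      using sum_le_suminf[OF sum, of "{..<n}"] le by (simp add: log_weight_nonneg)
    note exp_le' = exp_le[OF this]
    have "(\<integral>\<^sup>+s. ennreal (exp (a * norm (f s) powr (1 / b))) \<partial>M) \<le> ennreal A"
    \<comment> \<open>The uniform bound for partial sums passes to \<open>f\<close> along the almost
      everywhere convergent subsequence.\<close>
    proof (rule nn_integral_le_of_AE_LIMSEQ)
      have [measurable]: "(\<lambda>s. norm (fourier_sum c n s)) \<in> borel_measurable M" for n
        by (intro strongly_measurable_norm strongly_measurable_fourier_sum)
      show "(\<lambda>s. ennreal (exp (a * norm (fourier_sum c (r j) s) powr (1 / b)))) \<in> borel_measurable M" for j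
        by measurable
      show "AE s in M. (\<lambda>j. ennreal (exp (a * norm (fourier_sum c (r j) s) powr (1 / b))))
          \<longlonglongrightarrow> ennreal (exp (a * norm (f s) powr (1 / b)))"
        using lim
      proof eventually_elim
        case (elim s)
        have "(\<lambda>j. norm (fourier_sum c (r j) s) powr (1 / b)) \<longlonglongrightarrow> norm (f s) powr (1 / b)"
          \<comment> \<open>Positivity of the exponent \<open>1 / b\<close> covers the points where
            \<open>f s = 0\<close>.\<close>
          using \<open>b > 0\<close> by (intro tendsto_powr' tendsto_norm elim tendsto_const) auto
        then show ?case
          by (intro tendsto_ennrealI tendsto_exp tendsto_mult tendsto_const)
      qed
    qed (simp add: exp_le')
    with f show ?thesis by blast
  qed
  with \<open>a > 0\<close> \<open>A > 0\<close> show ?thesis by blast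
qed

end
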